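(* Let $S\subset \mathbb{N}^p$ be an affine semigroup minimally generated by $\Lambda_S=\{\mathbf{s}_1,\ldots,\mathbf{s}_n\}$, let $\mathcal{C}_S=L(S)\cap\mathbb{N}^p$, and let $\tau_1,\ldots,\tau_q$ be the extremal rays of $L(S)$. Then $S$ is a $\mathcal{C}_S$-semigroup (that is, $\mathcal{C}_S\setminus S$ is finite) if and only if both of the following hold: 1. $\tau_i\cap(\mathcal{C}_S\setminus S)$ is finite for all $i\in[q]$; 2. $\Lambda_S\cap \upsilon_i(\alpha)\neq\emptyset$ for all $\alpha\in\Gamma_i$ and all $i\in[q]$.
   Context: $\mathbb{N}$ is the set of non-negative integers and $[n]=\{1,\ldots,n\}$. An affine semigroup is a finitely generated submonoid of $\mathbb{N}^p$ (it contains $0$); $\Lambda_S$ denotes its minimal generating set. For $B\subset\mathbb{R}^p_{\ge}$, $L(B)$ is the set of finite linear combinations of elements of $B$ with non-negative real coefficients. Put $\mathcal{C}_S=L(S)\cap\mathbb{N}^p$. An affine semigroup $S\subset\mathcal{C}$ is a $\mathcal{C}$-semigroup if $\mathcal{C}\setminus S$ is finite. Let $h_1(x)=0,\ldots,h_t(x)=0$ be the supported hyperplanes of the polyhedral cone $L(S)$ (those defining its facets), where each $h_j$ is a linear form with relatively prime integer coefficients and $L(S)=\{x\in\mathbb{R}^p_{\ge}\mid h_1(x)\ge 0,\ldots,h_t(x)\ge 0\}$. Let $\tau_1,\ldots,\tau_q$ be the extremal rays of $L(S)$. For $i\in[q]$, let $J_i=\{j_1<\cdots<j_{p-1}\}\subset[t]$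 be the index set of the supported hyperplanes containing $\tau_i$; it is assumed to have $p-1$ elements and the equations $h_j(x)=0$, $j\in J_i$, determine $\tau_i$ (their common solution set is the line spanned by $\tau_i$). Let $\mathbf{a}_i$ be the minimal non-zero non-negative integer vector with $\tau_i=\{\lambda\mathbf{a}_i\mid\lambda\in\mathbb{R}_{\ge}\}$. For $\alpha=(\alpha_{j_1},\ldots,\alpha_{j_{p-1}})\in\mathbb{Z}^{p-1}$, $\upsilon_i(\alpha)$ is the line, parallel to $\tau_i$, of solutions $x\in\mathbb{R}^p$ of $h_j(x)=\alpha_j$ for all $j\in J_i$. For $P\in\mathcal{C}_S$, $\Upsilon_i(P)=(h_{j_1}(P),\ldots,h_{j_{p-1}}(P))\in\mathbb{N}^{p-1}$. Let $\mathcal{A}=\{\sum_{i\in[q]}\lambda_i\mathbf{a}_i\mid 0\le\lambda_i\le 1\}\cap\mathbb{N}^p$. For $i\in[q]$, $T_i\subset\mathbb{N}^{p-1}$ is the monoid generated by the finite set $\{\Upsilon_i(Q)\mid Q\in\mathcal{A}\}$, and $\Gamma_i$ is its minimal generating set. *)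

theory Defs
  imports "HOL-Analysis.Analysis" "HOL-Library.Function_Algebras"
begin

definition add_submonoid :: "'a::comm_monoid_add set \<Rightarrow> bool" where
  "add_submonoid M \<longleftrightarrow> 0 \<in> M \<and> (\<forall>x\<in>M. \<forall>y\<in>M. x + y \<in> M)"

definition minimal_generating_set :: "'a::comm_monoid_add set \<Rightarrow> 'a set \<Rightarrow> bool" where
  "minimal_generating_set G M \<longleftrightarrow>
     add_submonoid hull G = M \<and> (\<forall>H. H \<subset> G \<longrightarrow> add_submonoid hull H \<noteq> M)"

definition affine_semigroup :: "(nat^'p) set \<Rightarrow> bool" where
  "affine_semigroup S \<longleftrightarrow> (\<exists>B. finite B \<and> S = add_submonoid hull B)"

definition of_nat_vec :: "nat^'p \<Rightarrow> 'a::semiring_1^'p" where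
  "of_nat_vec x = (\<chi> k. of_nat (x $ k))"

definition real_cone :: "(real^'p) set \<Rightarrow> (real^'p) set" where
  "real_cone B = {\<Sum>b\<in>F. c b *\<^sub>R b | F c. finite F \<and> F \<subseteq> B \<and> (\<forall>b\<in>F. 0 \<le> c b)}"

abbreviation cone_of :: "(nat^'p) set \<Rightarrow> (real^'p) set" where
  "cone_of S \<equiv> real_cone (of_nat_vec ` S)"

definition lattice_cone :: "(nat^'p) set \<Rightarrow> (nat^'p) set" where
  "lattice_cone S = {x. of_nat_vec x \<in> cone_of S}"

definition C_semigroup :: "(nat^'p) set \<Rightarrow> (nat^'p) set \<Rightarrow> bool" where
  "C_semigroup C S \<longleftrightarrow> affine_semigroup S \<and> S \<subseteq> C \<and> finite (C - S)"

definition lin_form :: "int^'p \<Rightarrow> 'a::ring_1^'p \<Rightarrow> 'a" where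
  "lin_form h x = (\<Sum>k\<in>UNIV. of_int (h $ k) * x $ k)"

text \<open>The linear forms \<open>h 1, \<dots>, h t\<close> correspond one-to-one to the facets of \<open>L\<close>. Every form is
  positive at the relative interior points of \<open>L\<close>, so the last conjunct forces \<open>L\<close> to be
  full-dimensional; hence the forms are uniquely determined by \<open>L\<close> up to numbering.\<close>

definition supported_hyperplanes :: "(real^'p) set \<Rightarrow> nat \<Rightarrow> (nat \<Rightarrow> int^'p) \<Rightarrow> bool" where
  "supported_hyperplanes L t h \<longleftrightarrow>
     (\<forall>j\<in>{1..t}. Gcd (range (($) (h j))) = 1) \<and>
     bij_betw (\<lambda>j. L \<inter> {x. lin_form (h j) x = 0}) {1..t} {F. F facet_of L} \<and>
     L = {x. (\<forall>k. 0 \<le> x $ k) \<and> (\<forall>j\<in>{1..t}. 0 \<le> lin_form (h j) x)}"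

text \<open>As \<open>L\<close> lies in the non-negative orthant, its one-dimensional faces are rays from the origin.\<close>

definition extremal_rays :: "(real^'p) set \<Rightarrow> nat \<Rightarrow> (nat \<Rightarrow> (real^'p) set) \<Rightarrow> bool" where
  "extremal_rays L q \<tau> \<longleftrightarrow> bij_betw \<tau> {1..q} {T. T edge_of L}"

definition ray_through :: "nat^'p \<Rightarrow> (real^'p) set" where
  "ray_through a = {l *\<^sub>R of_nat_vec a | l. 0 \<le> l}"

definition minimal_ray_vector :: "nat^'p \<Rightarrow> (real^'p) set \<Rightarrow> bool" where
  "minimal_ray_vector a T \<longleftrightarrow>
     a \<noteq> 0 \<and> T = ray_through a \<and> (\<forall>b. b \<noteq> 0 \<and> T = ray_through b \<longrightarrow> (\<forall>k. a $ k \<le> b $ k))"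

definition hyperplanes_containing :: "nat \<Rightarrow> (nat \<Rightarrow> int^'p) \<Rightarrow> (real^'p) set \<Rightarrow> nat set" where
  "hyperplanes_containing t h T = {j\<in>{1..t}. T \<subseteq> {x. lin_form (h j) x = 0}}"

definition solution_line :: "(nat \<Rightarrow> int^'p) \<Rightarrow> nat set \<Rightarrow> (nat \<Rightarrow> int) \<Rightarrow> (real^'p) set" where
  "solution_line h J \<alpha> = {x. \<forall>j\<in>J. lin_form (h j) x = of_int (\<alpha> j)}"

text \<open>An integer tuple indexed by a finite set \<open>J\<close> is encoded as a function that is zero outside
  \<open>J\<close>, with the pointwise addition of functions. On points of the cone the values of
  \<open>hyperplane_values\<close> are non-negative.\<close>

definition hyperplane_values :: "(nat \<Rightarrow> int^'p) \<Rightarrow> nat set \<Rightarrow> nat^'p \<Rightarrow> nat \<Rightarrow> int" where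
  "hyperplane_values h J P = (\<lambda>j. if j \<in> J then lin_form (h j) (of_nat_vec P) else 0)"

definition box_points :: "nat \<Rightarrow> (nat \<Rightarrow> nat^'p) \<Rightarrow> (nat^'p) set" where
  "box_points q a = {x. \<exists>l. (\<forall>i\<in>{1..q}. 0 \<le> l i \<and> l i \<le> 1) \<and>
     (of_nat_vec x :: real^'p) = (\<Sum>i\<in>{1..q}. l i *\<^sub>R of_nat_vec (a i))}"

definition value_monoid ::
    "nat \<Rightarrow> (nat \<Rightarrow> nat^'p) \<Rightarrow> (nat \<Rightarrow> int^'p) \<Rightarrow> nat set \<Rightarrow> (nat \<Rightarrow> int) set" where
  "value_monoid q a h J = add_submonoid hull (hyperplane_values h J ` box_points q a)"

end

theory Submission
  imports Defs
begin

text \<open>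
  Write \<open>C\<close> for the lattice points of the cone \<open>L\<close> of \<open>S\<close>, and \<open>\<Upsilon>\<^sub>i(P)\<close> for the tuple of values at \<open>P\<close>
  of the forms that vanish on \<open>\<tau>\<^sub>i\<close>.  Two points have the same \<open>\<Upsilon>\<^sub>i\<close> exactly when they differ by a
  multiple of \<open>a\<^sub>i\<close>, and \<open>\<Upsilon>\<^sub>i\<close> is additive and non-negative on \<open>C\<close>.

  The cone is generated by its extremal rays (\<open>pointed_cone_spanned_by_edges\<close>, which is the
  Krein--Milman theorem applied to a compact slice).  Rounding the coefficients down, every point of
  \<open>C\<close> is a box point plus a combination of the \<open>a\<^sub>i\<close> with coefficients in \<open>\<nat>\<close>
  (\<open>lattice_point_box_decomposition\<close>).  Hence the box points generate \<open>C\<close>, and the monoid \<open>T\<^sub>i\<close> is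
  simply \<open>\<Upsilon>\<^sub>i(C)\<close>.

  Suppose that \<open>C - S\<close> is finite, and let \<open>\<alpha> = \<Upsilon>\<^sub>i(Q)\<close> be a minimal generator of \<open>T\<^sub>i\<close>.  Some translate
  \<open>Q + k a\<^sub>i\<close> lies in \<open>S\<close> and still has value \<open>\<alpha>\<close>.  Since \<open>\<alpha>\<close> is irreducible in \<open>T\<^sub>i\<close>
  (\<open>minimal_generator_irreducible\<close>), when this translate is written as a sum of elements of \<open>\<Lambda>\<close> one
  summand has value \<open>\<alpha>\<close> and all the others have value \<open>0\<close>; so \<open>\<Lambda>\<close> meets the line of \<open>\<alpha>\<close>.

  Conversely, suppose that each \<open>\<Gamma>\<^sub>i\<close> consists of values of elements of \<open>\<Lambda>\<close>.  Then
  \<open>\<Upsilon>\<^sub>i(C) = \<Upsilon>\<^sub>i(S)\<close>, so every \<open>P\<close> in \<open>C\<close> lies on a line through some \<open>s\<close> in \<open>S\<close> parallel to \<open>\<tau>\<^sub>i\<close>.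
  For large \<open>k\<close> the difference of \<open>P + k a\<^sub>i\<close> and \<open>s\<close> is a lattice point far out on \<open>\<tau>\<^sub>i\<close>, hence in \<open>S\<close>
  by the first condition, and so \<open>P + k a\<^sub>i\<close> is in \<open>S\<close>
  (\<open>eventually_translate_in_submonoid\<close>).  That this happens for every \<open>P\<close> and every direction
  forces \<open>C - S\<close> to be finite (\<open>finite_complement_of_submonoid\<close>).
\<close>

section \<open>Submonoids and minimal generators\<close>

lemma add_submonoidI:
  assumes "0 \<in> M" "\<And>x y. x \<in> M \<Longrightarrow> y \<in> M \<Longrightarrow> x + y \<in> M"
  shows "add_submonoid M"
  using assms by (simp add: add_submonoid_def)

lemma add_submonoid_hull: "add_submonoid (add_submonoid hull G)"
  by (rule hull_in) (auto simp: add_submonoid_def)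

lemma add_submonoid_sum:
  assumes "add_submonoid M" "\<And>i. i \<in> I \<Longrightarrow> f i \<in> M"
  shows "sum f I \<in> M"
  using assms(2)
  by (induction I rule: infinite_finite_induct) (use assms(1) in \<open>auto simp: add_submonoid_def\<close>)

text \<open>In a sum of generators the generator \<open>g\<close> either does not occur, or one copy of it can be split
  off.  This replaces an explicit bookkeeping of the coefficients of a sum.\<close>

lemma hull_split_generator:
  assumes "g \<in> G" "w \<in> add_submonoid hull G"
  shows "w \<in> add_submonoid hull (G - {g}) \<or> (\<exists>w'\<in>add_submonoid hull G. w = g + w')"
proof -
  let ?M = "add_submonoid hull G" and ?M' = "add_submonoid hull (G - {g})"
  have 0: "0 \<in> ?M" "0 \<in> ?M'"
    using add_submonoid_hull by (auto simp: add_submonoid_def)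
  have add: "x + y \<in> ?M" if "x \<in> ?M" "y \<in> ?M" for x y
    using add_submonoid_hull that by (auto simp: add_submonoid_def)
  have add': "x + y \<in> ?M'" if "x \<in> ?M'" "y \<in> ?M'" for x y
    using add_submonoid_hull that by (auto simp: add_submonoid_def)
  have sub: "?M' \<subseteq> ?M"
    by (rule hull_mono) auto
  have sub': "(+) g ` ?M \<subseteq> ?M"
    using assms(1) add by (auto intro: hull_inc)
  have "?M \<subseteq> ?M' \<union> (+) g ` ?M"
  proof (rule hull_minimal)
    show "G \<subseteq> ?M' \<union> (+) g ` ?M"
      using 0 by (force intro: hull_inc)
    show "add_submonoid (?M' \<union> (+) g ` ?M)"
    proof (rule add_submonoidI)
      fix x y assume xy: "x \<in> ?M' \<union> (+) g ` ?M" "y \<in> ?M' \<union> (+) g ` ?M"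
      then have M: "x \<in> ?M" "y \<in> ?M"
        using sub sub' by auto
      consider "x \<in> ?M'" "y \<in> ?M'" | x' where "x' \<in> ?M" "x = g + x'" | y' where "y' \<in> ?M" "y = g + y'"
        using xy by blast
      then show "x + y \<in> ?M' \<union> (+) g ` ?M"
      proof cases
        case 1
        then show ?thesis using add' by blast
      next
        case 2
        then have "x + y = g + (x' + y)" by (simp add: add.assoc)
        then show ?thesis using add[OF 2(1) M(2)] by blast
      next
        case 3
        then have "x + y = g + (x + y')" by (simp add: add.left_commute)
        then show ?thesis using add[OF M(1) 3(1)] by blast
      qed
    qed (use 0 in auto)
  qed
  then show ?thesis
    using assms(2) by blast
qed

text \<open>If \<open>g = x + y\<close>, then one of \<open>x\<close>, \<open>y\<close> must involve \<open>g\<close>, since otherwise \<open>g\<close> would be redundant.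
  Cancelling that copy of \<open>g\<close> leaves a sum equal to \<open>0\<close>, and a monoid without non-zero inverses
  allows this only if the other summand is \<open>0\<close>.\<close>

lemma minimal_generator_irreducible:
  fixes M :: "'a::cancel_comm_monoid_add set"
  assumes min: "minimal_generating_set G M" and g: "g \<in> G"
    and pointed: "\<And>x y. x \<in> M \<Longrightarrow> y \<in> M \<Longrightarrow> x + y = 0 \<Longrightarrow> x = 0"
  shows "g \<noteq> 0" and "x \<in> M \<Longrightarrow> y \<in> M \<Longrightarrow> g = x + y \<Longrightarrow> x = 0 \<or> y = 0"
proof -
  have M: "add_submonoid hull G = M"
    using min by (simp add: minimal_generating_set_def)
  have notin: "g \<notin> add_submonoid hull (G - {g})"
  proof
    assume "g \<in> add_submonoid hull (G - {g})"
    then have "G \<subseteq> add_submonoid hull (G - {g})"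
      using hull_subset[of "G - {g}" add_submonoid] by auto
    then have "add_submonoid hull G \<subseteq> add_submonoid hull (G - {g})"
      by (simp add: hull_minimal add_submonoid_hull)
    moreover have "add_submonoid hull (G - {g}) \<subseteq> add_submonoid hull G"
      by (rule hull_mono) auto
    moreover have "G - {g} \<subset> G"
      using g by auto
    ultimately show False
      using min M unfolding minimal_generating_set_def by blast
  qed
  then show "g \<noteq> 0"
    using add_submonoid_hull[of "G - {g}"] by (auto simp: add_submonoid_def)
  assume x: "x \<in> M" and y: "y \<in> M" and e: "g = x + y"
  have add: "u + v \<in> M" if "u \<in> M" "v \<in> M" for u v
    using add_submonoid_hull[of G] that M by (auto simp: add_submonoid_def)
  have "x \<notin> add_submonoid hull (G - {g}) \<or> y \<notin> add_submonoid hull (G - {g})"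
    using notin e add_submonoid_hull[of "G - {g}"] by (auto simp: add_submonoid_def)
  then consider x' where "x' \<in> M" "x = g + x'" | y' where "y' \<in> M" "y = g + y'"
    using hull_split_generator[OF g, of x] hull_split_generator[OF g, of y] x y M by blast
  then show "x = 0 \<or> y = 0"
  proof cases
    case 1
    then have "g + (y + x') = g + 0" using e by (simp add: ac_simps)
    then have "y + x' = 0" by (simp only: add_left_cancel)
    then show ?thesis using pointed y 1 by blast
  next
    case 2
    then have "g + (x + y') = g + 0" using e by (simp add: ac_simps)
    then have "x + y' = 0" by (simp only: add_left_cancel)
    then show ?thesis using pointed x 2 by blast
  qed
qed

lemma hull_image_additive:
  assumes "f 0 = 0" and "\<And>x y. f (x + y) = f x + f y"
  shows "add_submonoid hull (f ` B) = f ` (add_submonoid hull B)"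
proof
  show "add_submonoid hull (f ` B) \<subseteq> f ` (add_submonoid hull B)"
  proof (rule hull_minimal)
    show "f ` B \<subseteq> f ` (add_submonoid hull B)"
      by (intro image_mono hull_subset)
    show "add_submonoid (f ` (add_submonoid hull B))"
    proof (rule add_submonoidI)
      show "0 \<in> f ` (add_submonoid hull B)"
        using add_submonoid_hull[of B] assms(1) by (force simp: add_submonoid_def)
      fix x y assume "x \<in> f ` (add_submonoid hull B)" "y \<in> f ` (add_submonoid hull B)"
      then obtain u v where "u \<in> add_submonoid hull B" "v \<in> add_submonoid hull B" "x + y = f (u + v)"
        by (auto simp: assms(2))
      then show "x + y \<in> f ` (add_submonoid hull B)"
        using add_submonoid_hull[of B] by (auto simp: add_submonoid_def)
    qed
  qed
  have "add_submonoid hull B \<subseteq> {x. f x \<in> add_submonoid hull (f ` B)}"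
    using add_submonoid_hull[of "f ` B"] assms
    by (intro hull_minimal) (auto simp: add_submonoid_def intro: hull_inc)
  then show "f ` (add_submonoid hull B) \<subseteq> add_submonoid hull (f ` B)"
    by auto
qed

text \<open>The point \<open>x = P + (\<Sum>i\<in>I. of_nat (n i) * a i)\<close> is in \<open>S\<close> as soon as one coefficient is large.  The
  hypothesis \<open>ev\<close> absorbs only one direction at a time, so the coefficients are divided at a
  threshold \<open>M\<close> beyond which the multiples of each \<open>a i\<close> are in \<open>S\<close>: the small ones are absorbed
  into \<open>P\<close>, which produces a finite set \<open>B\<close> of base points, and the large ones can be added freely
  to an element of \<open>S\<close>.  The second threshold \<open>K\<close> is uniform over \<open>B\<close>.

  The type class makes multiples available as products with \<open>of_nat k\<close>; on vectors of natural
  numbers, where the product is componentwise, \<open>of_nat k * a\<close> is the \<open>k\<close>-fold multiple of \<open>a\<close>.\<close>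

lemma finite_complement_of_submonoid:
  fixes a :: "'i \<Rightarrow> 'a::comm_semiring_1"
  assumes "finite A" "finite I" and S: "add_submonoid S"
    and C: "add_submonoid C" "A \<subseteq> C" "\<And>i. i \<in> I \<Longrightarrow> a i \<in> C"
    and decomp: "\<And>x. x \<in> C \<Longrightarrow> \<exists>P\<in>A. \<exists>n::'i \<Rightarrow> nat. x = P + (\<Sum>i\<in>I. of_nat (n i) * a i)"
    and ev: "\<And>P i. P \<in> C \<Longrightarrow> i \<in> I \<Longrightarrow> eventually (\<lambda>k. P + of_nat k * a i \<in> S) sequentially"
  shows "finite (C - S)"
proof -
  have 0: "0 \<in> C" using C(1) by (simp add: add_submonoid_def)
  have mult: "of_nat k * a i \<in> C" if "i \<in> I" for i k
    using C(1) C(3)[OF that] 0 by (induction k) (auto simp: add_submonoid_def algebra_simps)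
  have "eventually (\<lambda>k. \<forall>i\<in>I. of_nat k * a i \<in> S) sequentially"
    using ev[OF 0] assms(2) by (simp add: eventually_ball_finite)
  then obtain M where M: "\<And>k i. M \<le> k \<Longrightarrow> i \<in> I \<Longrightarrow> of_nat k * a i \<in> S"
    by (auto simp: eventually_sequentially)
  define B where "B = (\<lambda>(P, m). P + (\<Sum>i\<in>I. of_nat (m i) * a i)) ` (A \<times> (I \<rightarrow>\<^sub>E {..M}))"
  have "finite B"
    unfolding B_def using assms(1,2) by (intro finite_imageI finite_cartesian_product finite_PiE) auto
  have "(\<Sum>i\<in>I. of_nat (m i) * a i) \<in> C" for m
    using C(1) mult by (rule add_submonoid_sum)
  then have "B \<subseteq> C"
    unfolding B_def using C(1,2) by (auto simp: add_submonoid_def)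
  have "eventually (\<lambda>k. \<forall>P\<in>B. \<forall>i\<in>I. P + of_nat k * a i \<in> S) sequentially"
    using ev \<open>finite B\<close> \<open>B \<subseteq> C\<close> assms(2) by (intro eventually_ball_finite ballI) auto
  then obtain K where K: "\<And>k P i. K \<le> k \<Longrightarrow> P \<in> B \<Longrightarrow> i \<in> I \<Longrightarrow> P + of_nat k * a i \<in> S"
    unfolding eventually_sequentially by blast
  define D where "D = (\<lambda>(P, m). P + (\<Sum>i\<in>I. of_nat (m i) * a i)) ` (A \<times> (I \<rightarrow>\<^sub>E {..max M K}))"
  have "finite D"
    unfolding D_def using assms(1,2) by (intro finite_imageI finite_cartesian_product finite_PiE) auto
  moreover have "C - S \<subseteq> D"
  proof
    fix x assume x: "x \<in> C - S"
    then obtain P n where P: "P \<in> A" and xn: "x = P + (\<Sum>i\<in>I. of_nat (n i) * a i)"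
      using decomp by blast
    have "n i \<le> max M K" if i: "i \<in> I" for i
    proof (rule ccontr)
      assume "\<not> n i \<le> max M K"
      then have ni: "M < n i" "K < n i" by auto
      define G where "G = {j\<in>I. M < n j}"
      \<comment> \<open>\<open>m\<close> keeps the small coefficients, so the base point \<open>Q\<close> below is in \<open>B\<close>; \<open>G\<close> indexes the large ones.\<close>
      define m where "m = (\<lambda>j\<in>I. if M < n j then 0 else n j)"
      define Q where "Q = P + (\<Sum>j\<in>I. of_nat (m j) * a j)"
      have "Q \<in> B"
        unfolding B_def Q_def using P by (intro image_eqI[of _ _ "(P, m)"]) (auto simp: m_def)
      have "i \<in> G" "finite G"
        using i ni assms(2) by (auto simp: G_def)
      have "(\<Sum>j\<in>I. of_nat (n j) * a j) = (\<Sum>j\<in>I. of_nat (m j) * a j) + (\<Sum>j\<in>G. of_nat (n j) * a j)"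
      proof -
        have "(\<Sum>j\<in>G. of_nat (n j) * a j) = (\<Sum>j\<in>I. if M < n j then of_nat (n j) * a j else 0)"
          using assms(2) by (simp add: G_def sum.inter_filter)
        then show ?thesis
          by (auto simp: sum.distrib[symmetric] m_def intro!: sum.cong)
      qed
      also have "(\<Sum>j\<in>G. of_nat (n j) * a j) = of_nat (n i) * a i + (\<Sum>j\<in>G - {i}. of_nat (n j) * a j)"
        using \<open>i \<in> G\<close> \<open>finite G\<close> by (simp add: sum.remove)
      finally have "x = (Q + of_nat (n i) * a i) + (\<Sum>j\<in>G - {i}. of_nat (n j) * a j)"
        by (simp add: xn Q_def ac_simps)
      moreover have "Q + of_nat (n i) * a i \<in> S"
        using K[OF _ \<open>Q \<in> B\<close> i] ni by simp
      moreover have "(\<Sum>j\<in>G - {i}. of_nat (n j) * a j) \<in> S"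
        using S M by (intro add_submonoid_sum) (auto simp: G_def)
      ultimately have "x \<in> S"
        using S by (simp add: add_submonoid_def)
      with x show False by simp
    qed
    then show "x \<in> D"
      unfolding D_def xn using P
      by (intro image_eqI[of _ _ "(P, restrict n I)"]) auto
  qed
  ultimately show ?thesis
    by (rule finite_subset[rotated])
qed

section \<open>Pointed cones and their edges\<close>

text \<open>A segment in \<open>L\<close> that meets the ray through \<open>v\<close> in its interior is projected radially to the slice
  \<open>w \<bullet> x = 1\<close>.  There \<open>v\<close> is a convex combination of the projected endpoints with positive weights,
  so both of them are \<open>v\<close>, and the endpoints lie on the ray.\<close>

lemma ray_of_extreme_point_is_edge:
  fixes L :: "'a::euclidean_space set"
  assumes cone: "convex_cone L" and pos: "\<And>x. x \<in> L \<Longrightarrow> x \<noteq> 0 \<Longrightarrow> 0 < w \<bullet> x"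
    and ext: "v extreme_point_of {x \<in> L. w \<bullet> x = 1}"
  shows "((\<lambda>c. c *\<^sub>R v) ` {0..}) edge_of L"
proof -
  define R where "R = (\<lambda>c. c *\<^sub>R v) ` {0::real..}"
  have v: "v \<in> L" "w \<bullet> v = 1"
    using ext by (auto simp: extreme_point_of_def)
  have R0: "0 \<in> R"
    unfolding R_def by (rule image_eqI[of _ _ 0]) auto
  have inR: "c *\<^sub>R v \<in> R" if "0 \<le> c" for c
    using that by (auto simp: R_def)
  have conR: "convex R"
    unfolding R_def by (intro convex_linear_image) auto
  have split: "a \<in> R \<and> b \<in> R"
    if a: "a \<in> L" "a \<noteq> 0" and b: "b \<in> L" "b \<noteq> 0" and "0 < s" "0 < r" "0 \<le> l" and e: "l *\<^sub>R v = s *\<^sub>R a + r *\<^sub>R b"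
    for a b s r l
  proof -
    define \<alpha> \<beta> where "\<alpha> = w \<bullet> a" and "\<beta> = w \<bullet> b"
    have p: "0 < \<alpha>" "0 < \<beta>"
      using pos a b by (auto simp: \<alpha>_def \<beta>_def)
    have l: "l = s * \<alpha> + r * \<beta>"
      using arg_cong[OF e, of "(\<bullet>) w"] v(2) by (simp add: inner_add_right \<alpha>_def \<beta>_def)
    then have "0 < l"
      using p that(5,6) by (simp add: add_pos_pos)
    define a' b' where "a' = (1/\<alpha>) *\<^sub>R a" and "b' = (1/\<beta>) *\<^sub>R b"
    have sl: "a' \<in> {x \<in> L. w \<bullet> x = 1}" "b' \<in> {x \<in> L. w \<bullet> x = 1}"
      using p a b cone by (auto simp: a'_def b'_def \<alpha>_def \<beta>_def convex_cone_scaleR)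
    \<comment> \<open>The weight that \<open>b'\<close> receives after rescaling \<open>l *\<^sub>R v = s *\<^sub>R a + r *\<^sub>R b\<close> to the slice.\<close>
    define u where "u = r * \<beta> / l"
    have u: "0 < u" "u < 1" "1 - u = s * \<alpha> / l"
      using \<open>0 < l\<close> p that(5,6) by (auto simp: u_def l field_simps)
    have "v = (1 / l) *\<^sub>R (l *\<^sub>R v)"
      using \<open>0 < l\<close> by simp
    also have "\<dots> = (1 - u) *\<^sub>R a' + u *\<^sub>R b'"
      unfolding e u(3) using p by (simp add: u_def a'_def b'_def scaleR_add_right)
    finally have vab: "v = (1 - u) *\<^sub>R a' + u *\<^sub>R b'" .
    have "v \<notin> open_segment a' b'"
      using ext sl by (auto simp: extreme_point_of_def)
    with vab u have "a' = b'"
      by (auto simp: in_segment)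
    with vab have "v = a'" "v = b'"
      by (auto simp: scaleR_add_left[symmetric])
    moreover have "a = \<alpha> *\<^sub>R a'" "b = \<beta> *\<^sub>R b'"
      using p by (simp_all add: a'_def b'_def)
    ultimately show ?thesis
      using inR[of \<alpha>] inR[of \<beta>] p by simp
  qed
  have "R face_of L"
    unfolding face_of_def
  proof (intro conjI conR ballI impI)
    show "R \<subseteq> L"
      using v cone by (auto simp: R_def convex_cone_scaleR)
    fix a b x assume ab: "a \<in> L" "b \<in> L" and "x \<in> R" and "x \<in> open_segment a b"
    then obtain l u where l: "0 \<le> l" "x = l *\<^sub>R v" and u: "0 < u" "u < 1" "x = (1 - u) *\<^sub>R a + u *\<^sub>R b"
      by (auto simp: R_def in_segment)
    \<comment> \<open>The apex has no projection to the slice, so endpoints at \<open>0\<close> are treated separately.\<close>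
    consider "a = 0" | "b = 0" | "a \<noteq> 0" "b \<noteq> 0" by blast
    then have "a \<in> R \<and> b \<in> R"
    proof cases
      case 1
      with l u have "(l / u) *\<^sub>R v = (1 / u) *\<^sub>R (u *\<^sub>R b)"
        by (simp add: divide_inverse_commute flip: scaleR_scaleR)
      then have "b = (l / u) *\<^sub>R v"
        using u by simp
      then show ?thesis
        using 1 R0 inR[of "l / u"] l u by simp
    next
      case 2
      with l u have "(l / (1 - u)) *\<^sub>R v = (1 / (1 - u)) *\<^sub>R ((1 - u) *\<^sub>R a)"
        by (simp add: divide_inverse_commute flip: scaleR_scaleR)
      then have "a = (l / (1 - u)) *\<^sub>R v"
        using u by simp
      then show ?thesis
        using 2 R0 inR[of "l / (1 - u)"] l u by simp
    next
      case 3
      then show ?thesis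
        using split[of a b "1 - u" u l] ab u l by auto
    qed
    then show "a \<in> R" "b \<in> R" by auto
  qed
  moreover have "aff_dim R = 1"
  proof -
    have "v \<noteq> 0" using v(2) by auto
    have "R \<subseteq> span {v}"
      by (auto simp: R_def span_singleton)
    then have "dim R \<le> dim {v}" by (metis dim_span dim_subset)
    moreover have "dim {v} \<le> dim R"
      using inR[of 1] by (intro dim_subset) auto
    moreover have "dim {v} = 1"
      using \<open>v \<noteq> 0\<close> by (simp add: dim_singleton)
    ultimately show ?thesis
      using R0 by (simp add: aff_dim_zero hull_inc)
  qed
  ultimately show ?thesis
    by (simp add: edge_of_def R_def)
qed

text \<open>By compactness \<open>w \<bullet> x\<close> has a positive minimum \<open>d\<close> on the unit vectors of \<open>L\<close>; hence the points of the
  slice have norm at most \<open>1 / d\<close>.\<close>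

lemma compact_cone_slice:
  fixes L :: "'a::euclidean_space set"
  assumes "closed L" "convex_cone L" and pos: "\<And>x. x \<in> L \<Longrightarrow> x \<noteq> 0 \<Longrightarrow> 0 < w \<bullet> x"
  shows "compact {x \<in> L. w \<bullet> x = 1}"
proof -
  define K where "K = L \<inter> sphere 0 1"
  have "compact K"
    unfolding K_def using assms(1) by (simp add: closed_Int_compact)
  obtain d where d: "0 < d" "\<And>x. x \<in> K \<Longrightarrow> d \<le> w \<bullet> x"
  proof (cases "K = {}")
    case True
    then show ?thesis using that[of 1] by auto
  next
    case False
    then obtain y where "y \<in> K" "\<forall>x\<in>K. w \<bullet> y \<le> w \<bullet> x"
      using continuous_attains_inf[OF \<open>compact K\<close>, of "\<lambda>x. w \<bullet> x"] continuous_on_inner[OF continuous_on_const continuous_on_id, of K w]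
      by blast
    moreover from this have "y \<noteq> 0" "y \<in> L" by (auto simp: K_def)
    ultimately show ?thesis using that[of "w \<bullet> y"] pos by blast
  qed
  have "norm x \<le> 1 / d" if "x \<in> L" "w \<bullet> x = 1" for x
  proof -
    have "x \<noteq> 0" using that by auto
    then have "(1 / norm x) *\<^sub>R x \<in> K"
      using that assms(2) by (auto simp: K_def convex_cone_scaleR)
    then have "d \<le> 1 / norm x"
      using d(2) that(2) by fastforce
    then show ?thesis
      using d(1) \<open>x \<noteq> 0\<close> by (simp add: field_simps)
  qed
  then have "bounded {x \<in> L. w \<bullet> x = 1}"
    by (auto intro!: boundedI)
  moreover have "{x \<in> L. w \<bullet> x = 1} = L \<inter> {x. w \<bullet> x = 1}" by auto
  then have "closed {x \<in> L. w \<bullet> x = 1}"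
    using assms(1) by (simp add: closed_Int closed_hyperplane)
  ultimately show ?thesis
    by (simp add: compact_eq_bounded_closed)
qed

text \<open>The slice \<open>w \<bullet> x = 1\<close> is compact and convex, so it is the convex hull of its extreme points, each of
  which spans an edge; every non-zero point of the cone is a positive multiple of a point of the
  slice.\<close>

lemma pointed_cone_spanned_by_edges:
  fixes L :: "'a::euclidean_space set"
  assumes "closed L" and cone: "convex_cone L" and pos: "\<And>x. x \<in> L \<Longrightarrow> x \<noteq> 0 \<Longrightarrow> 0 < w \<bullet> x"
  shows "L \<subseteq> convex_cone hull \<Union>{T. T edge_of L}"
proof
  fix x assume x: "x \<in> L"
  let ?H = "convex_cone hull \<Union>{T. T edge_of L}" and ?K = "{x \<in> L. w \<bullet> x = 1}"
  show "x \<in> ?H"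
  proof (cases "x = 0")
    case True
    then show ?thesis by (simp add: convex_cone_hull_contains_0)
  next
    case False
    have K: "?K = convex hull {v. v extreme_point_of ?K}"
    proof (rule Krein_Milman_Minkowski)
      show "compact ?K"
        using compact_cone_slice assms by blast
      have "?K = L \<inter> {x. w \<bullet> x = 1}" by auto
      then show "convex ?K"
        using cone by (simp add: convex_Int convex_hyperplane convex_cone_def)
    qed
    have "v \<in> ?H" if "v extreme_point_of ?K" for v
    proof -
      have "v \<in> (\<lambda>c. c *\<^sub>R v) ` {0..}"
        by (rule image_eqI[of _ _ 1]) auto
      then show ?thesis
        using ray_of_extreme_point_is_edge[OF cone pos that] by (intro hull_inc) blast
    qed
    then have "convex hull {v. v extreme_point_of ?K} \<subseteq> ?H"
      by (intro hull_minimal) (auto simp: convex_convex_cone_hull)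
    moreover have "(1 / (w \<bullet> x)) *\<^sub>R x \<in> ?K"
      using x cone pos[OF x False] by (auto simp: convex_cone_scaleR)
    ultimately have "(1 / (w \<bullet> x)) *\<^sub>R x \<in> ?H"
      using K by blast
    then have "(w \<bullet> x) *\<^sub>R (1 / (w \<bullet> x)) *\<^sub>R x \<in> ?H"
      by (rule convex_cone_hull_mul) (use pos[OF x False] in simp)
    moreover have "(w \<bullet> x) *\<^sub>R (1 / (w \<bullet> x)) *\<^sub>R x = x"
      using pos[OF x False] by simp
    ultimately show ?thesis
      by (simp only:)
  qed
qed

section \<open>Lattice vectors and values of linear forms\<close>

lemma of_nat_vec_nth [simp]: "of_nat_vec x $ k = of_nat (x $ k)"
  by (simp add: of_nat_vec_def)

lemma of_nat_vec_0 [simp]: "of_nat_vec 0 = 0"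
  by (simp add: vec_eq_iff)

lemma of_nat_vec_add [simp]: "of_nat_vec (x + y) = of_nat_vec x + of_nat_vec y"
  by (simp add: vec_eq_iff)

lemma of_nat_vec_eq_iff [simp]: "(of_nat_vec x :: real^'p) = of_nat_vec y \<longleftrightarrow> x = y"
  by (simp add: vec_eq_iff)

lemma lin_form_0 [simp]: "lin_form h 0 = 0"
  by (simp add: lin_form_def)

lemma lin_form_add: "lin_form h (x + y) = lin_form h x + lin_form h y"
  by (simp add: lin_form_def distrib_left sum.distrib)

lemma lin_form_scaleR: "lin_form h (c *\<^sub>R x) = c * lin_form h (x :: real^'p)"
  by (simp add: lin_form_def sum_distrib_left mult.left_commute)

lemma lin_form_diff: "lin_form h (x - y) = lin_form h x - lin_form h y"
  by (simp add: lin_form_def right_diff_distrib sum_subtractf)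

lemma lin_form_of_nat_vec:
  "(lin_form h (of_nat_vec x) :: real) = of_int (lin_form h (of_nat_vec x))"
  by (simp add: lin_form_def)

lemma hyperplane_values_0: "hyperplane_values h J 0 = 0"
  by (simp add: hyperplane_values_def fun_eq_iff)

lemma hyperplane_values_add:
  "hyperplane_values h J (P + Q) = hyperplane_values h J P + hyperplane_values h J Q"
  by (simp add: hyperplane_values_def fun_eq_iff lin_form_add)

lemma hyperplane_values_mult:
  assumes "hyperplane_values h J P = 0"
  shows "hyperplane_values h J (of_nat k * P) = 0"
  by (induction k) (simp_all add: hyperplane_values_0 hyperplane_values_add assms distrib_right)

text \<open>Translates between the real line \<open>\<upsilon>\<^sub>i(\<alpha>)\<close> and integer values of the forms.  The hypothesis on \<open>\<alpha>\<close>
  says that it is an encoded tuple, which \<open>solution_line\<close> itself does not enforce.\<close>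

lemma of_nat_vec_in_solution_line_iff:
  assumes "\<And>j. j \<notin> J \<Longrightarrow> \<alpha> j = 0"
  shows "of_nat_vec P \<in> solution_line h J \<alpha> \<longleftrightarrow> hyperplane_values h J P = \<alpha>"
  using assms by (auto simp: solution_line_def hyperplane_values_def fun_eq_iff lin_form_of_nat_vec)

lemma closed_convex_cone_of_linear_inequalities:
  "closed {x :: real^'p. (\<forall>k. 0 \<le> x $ k) \<and> (\<forall>j\<in>A. 0 \<le> lin_form (h j) x)}"
  "convex_cone {x :: real^'p. (\<forall>k. 0 \<le> x $ k) \<and> (\<forall>j\<in>A. 0 \<le> lin_form (h j) x)}"
proof -
  have "continuous_on UNIV (lin_form (h j) :: real^'p \<Rightarrow> real)" for j
    unfolding lin_form_def by (intro continuous_intros)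
  then have "closed {x :: real^'p. 0 \<le> lin_form (h j) x}" for j
    by (intro closed_Collect_le) auto
  then have "closed ({x :: real^'p. \<forall>k. 0 \<le> x $ k} \<inter> (\<Inter>j\<in>A. {x. 0 \<le> lin_form (h j) x}))"
    by (intro closed_Int closed_INT closed_Collect_all closed_Collect_le continuous_intros) auto
  moreover have "{x :: real^'p. \<forall>k. 0 \<le> x $ k} \<inter> (\<Inter>j\<in>A. {x. 0 \<le> lin_form (h j) x})
      = {x. (\<forall>k. 0 \<le> x $ k) \<and> (\<forall>j\<in>A. 0 \<le> lin_form (h j) x)}"
    by auto
  ultimately show "closed {x :: real^'p. (\<forall>k. 0 \<le> x $ k) \<and> (\<forall>j\<in>A. 0 \<le> lin_form (h j) x)}"
    by simp
  show "convex_cone {x :: real^'p. (\<forall>k. 0 \<le> x $ k) \<and> (\<forall>j\<in>A. 0 \<le> lin_form (h j) x)}"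
    by (auto simp: convex_cone_iff lin_form_add lin_form_scaleR intro: exI[of _ 0])
qed

section \<open>Box points and rays\<close>

lemma convex_cone_hull_rays:
  fixes a :: "'i \<Rightarrow> nat^'p" and x :: "real^'p"
  assumes "finite I" "x \<in> convex_cone hull (\<Union>i\<in>I. ray_through (a i))"
  shows "\<exists>c. (\<forall>i\<in>I. 0 \<le> c i) \<and> x = (\<Sum>i\<in>I. c i *\<^sub>R of_nat_vec (a i))"
proof -
  let ?K = "{\<Sum>i\<in>I. c i *\<^sub>R of_nat_vec (a i) | c. \<forall>i\<in>I. 0 \<le> c i} :: (real^'p) set"
  have "convex_cone ?K"
    unfolding convex_cone_iff
  proof (intro conjI ballI allI impI)
    show "0 \<in> ?K"
      by (rule CollectI, rule exI[of _ "\<lambda>_. 0"]) simp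
    fix x y :: "real^'p" assume "x \<in> ?K" "y \<in> ?K"
    then obtain c d where c: "\<forall>i\<in>I. 0 \<le> c i" "x = (\<Sum>i\<in>I. c i *\<^sub>R of_nat_vec (a i))"
      and d: "\<forall>i\<in>I. 0 \<le> d i" "y = (\<Sum>i\<in>I. d i *\<^sub>R of_nat_vec (a i))"
      by blast
    then show "x + y \<in> ?K"
      by (intro CollectI exI[of _ "\<lambda>i. c i + d i"]) (simp add: scaleR_add_left sum.distrib)
  next
    fix x :: "real^'p" and r :: real assume "x \<in> ?K" "0 \<le> r"
    then obtain c where "\<forall>i\<in>I. 0 \<le> c i" "x = (\<Sum>i\<in>I. c i *\<^sub>R of_nat_vec (a i))"
      by blast
    then show "r *\<^sub>R x \<in> ?K"
      using \<open>0 \<le> r\<close> by (intro CollectI exI[of _ "\<lambda>i. r * c i"]) (simp add: scaleR_sum_right)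
  qed
  moreover have "(\<Union>i\<in>I. ray_through (a i)) \<subseteq> ?K"
  proof clarify
    fix i x assume "i \<in> I" "x \<in> ray_through (a i)"
    then obtain l where l: "0 \<le> l" "x = l *\<^sub>R of_nat_vec (a i)"
      by (auto simp: ray_through_def)
    have "(\<Sum>j\<in>I. (if j = i then l else 0) *\<^sub>R of_nat_vec (a j)) = (\<Sum>j\<in>I. if j = i then l *\<^sub>R of_nat_vec (a j) else 0 :: real^'p)"
      by (intro sum.cong) auto
    also have "\<dots> = x"
      using \<open>finite I\<close> \<open>i \<in> I\<close> l by (simp add: sum.delta)
    finally show "\<exists>c. x = (\<Sum>j\<in>I. c j *\<^sub>R of_nat_vec (a j)) \<and> (\<forall>j\<in>I. 0 \<le> c j)"
      using l(1) by (intro exI[of _ "\<lambda>j. if j = i then l else 0"]) auto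
  qed
  ultimately have "convex_cone hull (\<Union>i\<in>I. ray_through (a i)) \<subseteq> ?K"
    by (intro hull_minimal)
  then show ?thesis
    using assms(2) by blast
qed

lemma finite_box_points:
  fixes a :: "nat \<Rightarrow> nat^'p"
  shows "finite (box_points q a)"
proof -
  let ?F = "{f. \<forall>k. f k \<in> {..(\<Sum>i\<in>{1..q}. a i $ k)}}"
  have "finite ?F"
    using finite_PiE[of UNIV "\<lambda>k. {..(\<Sum>i\<in>{1..q}. a i $ k)}"] by (simp add: PiE_def Pi_def)
  moreover have "box_points q a \<subseteq> vec_lambda ` ?F"
  proof
    fix x assume "x \<in> box_points q a"
    then obtain l where l: "\<forall>i\<in>{1..q}. 0 \<le> l i \<and> l i \<le> 1"
      and x: "(of_nat_vec x :: real^'p) = (\<Sum>i\<in>{1..q}. l i *\<^sub>R of_nat_vec (a i))"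
      by (auto simp: box_points_def)
    have "x $ k \<le> (\<Sum>i\<in>{1..q}. a i $ k)" for k
    proof -
      have "real (x $ k) = (\<Sum>i\<in>{1..q}. l i * real (a i $ k))"
        using arg_cong[OF x, of "\<lambda>v. v $ k"] by simp
      also have "\<dots> \<le> (\<Sum>i\<in>{1..q}. real (a i $ k))"
        using l by (intro sum_mono mult_left_le_one_le) auto
      finally show ?thesis
        by (simp flip: of_nat_sum)
    qed
    then show "x \<in> vec_lambda ` ?F"
      by (intro image_eqI[of _ _ "vec_nth x"]) auto
  qed
  ultimately show ?thesis
    by (meson finite_imageI finite_subset)
qed

text \<open>Subtract the integer parts of the coefficients; the remainder has its coefficients in the unit
  interval, and it is a lattice point with non-negative coordinates.\<close>

lemma lattice_point_box_decomposition:
  assumes c: "\<forall>i\<in>{1..q}. 0 \<le> c i"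
    and x: "(of_nat_vec x :: real^'p) = (\<Sum>i\<in>{1..q}. c i *\<^sub>R of_nat_vec (a i))"
  shows "\<exists>P\<in>box_points q a. \<exists>n. x = P + (\<Sum>i\<in>{1..q}. of_nat (n i) * a i)"
proof -
  define n where "n = (\<lambda>i. nat \<lfloor>c i\<rfloor>)"
  have n: "real (n i) \<le> c i" "c i - real (n i) \<le> 1" if "i \<in> {1..q}" for i
    using c that by (auto simp: n_def) linarith
  define N where "N = (\<Sum>i\<in>{1..q}. of_nat (n i) * a i)"
  have N: "real (N $ k) = (\<Sum>i\<in>{1..q}. real (n i) * real (a i $ k))" for k
    by (simp add: N_def of_nat_index)
  have xk: "real (x $ k) = (\<Sum>i\<in>{1..q}. c i * real (a i $ k))" for k
    using arg_cong[OF x, of "\<lambda>v. v $ k"] by simp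
  have le: "N $ k \<le> x $ k" for k
  proof -
    have "real (N $ k) \<le> real (x $ k)"
      unfolding N xk using n by (intro sum_mono mult_right_mono) auto
    then show ?thesis by simp
  qed
  define P where "P = (\<chi> k. x $ k - N $ k)"
  have "(of_nat_vec P :: real^'p) = (\<Sum>i\<in>{1..q}. (c i - real (n i)) *\<^sub>R of_nat_vec (a i))"
    using le by (simp add: vec_eq_iff P_def of_nat_diff xk N left_diff_distrib sum_subtractf)
  then have "P \<in> box_points q a"
    unfolding box_points_def using n by (intro CollectI exI[of _ "\<lambda>i. c i - real (n i)"]) auto
  moreover have "x = P + N"
    using le by (simp add: vec_eq_iff P_def)
  ultimately show ?thesis
    unfolding N_def by blast
qed

lemma inj_translates:
  fixes a :: "nat^'p"
  assumes "a \<noteq> 0"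
  shows "inj (\<lambda>k. P + of_nat k * a)"
proof (rule injI)
  fix k l assume "P + of_nat k * a = P + of_nat l * a"
  then have *: "of_nat k * a = of_nat l * a" by simp
  obtain j where "a $ j \<noteq> 0" using assms by (auto simp: vec_eq_iff)
  then show "k = l"
    using arg_cong[OF *, of "\<lambda>v. v $ j"] by (simp add: of_nat_index)
qed

text \<open>For \<open>k \<ge> - r\<close> the vector \<open>d k = P + k a - s = (r + k) a\<close> is a lattice point on the ray of \<open>a\<close>.  Different
  \<open>k\<close> give different points, so only finitely many of them avoid \<open>S\<close>, and \<open>P + k a = s + d k\<close>.\<close>

lemma eventually_translate_in_submonoid:
  fixes a P s :: "nat^'p"
  assumes S: "add_submonoid S" "s \<in> S" and "a \<noteq> 0"
    and line: "of_nat_vec P - of_nat_vec s = r *\<^sub>R (of_nat_vec a :: real^'p)"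
    and fin: "finite (ray_through a \<inter> of_nat_vec ` (- S))"
  shows "eventually (\<lambda>k. P + of_nat k * a \<in> S) sequentially"
proof -
  define K where "K = nat \<lceil>- r\<rceil>"
  have K: "0 \<le> r + real k" if "K \<le> k" for k
    using that unfolding K_def by linarith
  have Pk: "real (P $ j) = real (s $ j) + r * real (a $ j)" for j
    using arg_cong[OF line, of "\<lambda>v. v $ j"] by simp
  define d where "d k = (\<chi> j. P $ j + k * a $ j - s $ j)" for k
  have le: "s $ j \<le> P $ j + k * a $ j" if "K \<le> k" for j k
  proof -
    have "real (P $ j + k * a $ j) = real (s $ j) + (r + real k) * real (a $ j)"
      by (simp add: Pk algebra_simps)
    then have "real (s $ j) \<le> real (P $ j + k * a $ j)"
      using K[OF that] by simp
    then show ?thesis by (simp only: of_nat_le_iff)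
  qed
  have sd: "P + of_nat k * a = s + d k" if "K \<le> k" for k
    using le[OF that] by (simp add: vec_eq_iff d_def of_nat_index)
  have "of_nat_vec (d k) = (r + real k) *\<^sub>R (of_nat_vec a :: real^'p)" if "K \<le> k" for k
    using le[OF that] by (simp add: vec_eq_iff d_def of_nat_diff Pk algebra_simps)
  then have ray: "of_nat_vec (d k) \<in> ray_through a" if "K \<le> k" for k
    using that K by (auto simp: ray_through_def)
  have "inj_on (\<lambda>k. of_nat_vec (d k) :: real^'p) {K..}"
  proof (rule inj_onI)
    fix k l assume kl: "k \<in> {K..}" "l \<in> {K..}" "(of_nat_vec (d k) :: real^'p) = of_nat_vec (d l)"
    then have "P + of_nat k * a = P + of_nat l * a"
      using sd by simp
    then show "k = l"
      using inj_translates[OF \<open>a \<noteq> 0\<close>] by (metis injD)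
  qed
  then have "finite {k \<in> {K..}. d k \<notin> S}"
    using fin ray
    by (intro inj_on_finite[of "\<lambda>k. of_nat_vec (d k) :: real^'p" _ "ray_through a \<inter> of_nat_vec ` (- S)"])
       (auto intro: inj_on_subset)
  then have "eventually (\<lambda>k. k \<notin> {k \<in> {K..}. d k \<notin> S}) sequentially"
    by (simp add: eventually_cofinite flip: cofinite_eq_sequentially)
  then show ?thesis
    using eventually_ge_at_top[of K]
  proof eventually_elim
    case (elim k)
    then have "d k \<in> S" by simp
    then show ?case
      using S sd[OF elim(2)] by (simp add: add_submonoid_def)
  qed
qed

section \<open>Semigroups with finite complement in their cone\<close>

theorem theorem9:
  fixes S \<Lambda> :: "(nat^'p) set"
    and t q :: nat
    and h :: "nat \<Rightarrow> int^'p"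
    and \<tau> :: "nat \<Rightarrow> (real^'p) set"
    and J :: "nat \<Rightarrow> nat set"
    and a :: "nat \<Rightarrow> nat^'p"
    and \<Gamma> :: "nat \<Rightarrow> (nat \<Rightarrow> int) set"
  assumes "affine_semigroup S"
    and "finite \<Lambda>" and "minimal_generating_set \<Lambda> S"
    and "supported_hyperplanes (cone_of S) t h"
    and "extremal_rays (cone_of S) q \<tau>"
    and "\<And>i. i \<in> {1..q} \<Longrightarrow> J i = hyperplanes_containing t h (\<tau> i)"
    and "\<And>i. i \<in> {1..q} \<Longrightarrow> card (J i) = CARD('p) - 1"
    and "\<And>i. i \<in> {1..q} \<Longrightarrow> {x :: real^'p. \<forall>j\<in>J i. lin_form (h j) x = 0} = span (\<tau> i)"
    and "\<And>i. i \<in> {1..q} \<Longrightarrow> minimal_ray_vector (a i) (\<tau> i)"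
    and "\<And>i. i \<in> {1..q} \<Longrightarrow> minimal_generating_set (\<Gamma> i) (value_monoid q a h (J i))"
  shows "C_semigroup (lattice_cone S) S \<longleftrightarrow>
    (\<forall>i\<in>{1..q}. finite (\<tau> i \<inter> of_nat_vec ` (lattice_cone S - S))) \<and>
    (\<forall>i\<in>{1..q}. \<forall>\<alpha>\<in>\<Gamma> i. of_nat_vec ` \<Lambda> \<inter> solution_line h (J i) \<alpha> \<noteq> {})"
proof -
  define L where "L = cone_of S"
  define C where "C = lattice_cone S"
  have C_iff: "x \<in> C \<longleftrightarrow> of_nat_vec x \<in> L" for x
    by (simp add: C_def L_def lattice_cone_def)
  have L_eq: "L = {x. (\<forall>k. 0 \<le> x $ k) \<and> (\<forall>j\<in>{1..t}. 0 \<le> lin_form (h j) x)}"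
    using assms(4) by (simp add: supported_hyperplanes_def L_def)
  have "closed L" and cone: "convex_cone L"
    unfolding L_eq by (rule closed_convex_cone_of_linear_inequalities)+
  have C_sub: "add_submonoid C"
    using cone by (intro add_submonoidI) (simp_all add: C_iff convex_cone_contains_0 convex_cone_add)
  have S_hull: "S = add_submonoid hull \<Lambda>"
    using assms(3) by (simp add: minimal_generating_set_def)
  have S_sub: "add_submonoid S"
    unfolding S_hull by (rule add_submonoid_hull)
  have "S \<subseteq> C"
  proof
    fix x assume "x \<in> S"
    then have "of_nat_vec x \<in> L"
      unfolding L_def real_cone_def
      by (intro CollectI exI[of _ "{of_nat_vec x}"] exI[of _ "\<lambda>_. 1"]) auto
    then show "x \<in> C" by (simp add: C_iff)
  qed

  have edges: "{T. T edge_of L} = \<tau> ` {1..q}"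
    using assms(5) by (simp add: extremal_rays_def L_def bij_betw_def)
  have ray: "\<tau> i = ray_through (a i)" and a0: "a i \<noteq> 0" if "i \<in> {1..q}" for i
    using assms(9)[OF that] by (simp_all add: minimal_ray_vector_def)
  have ray_L: "\<tau> i \<subseteq> L" if "i \<in> {1..q}" for i
    using edges that edge_of_imp_subset by blast
  have a_ray: "of_nat_vec (a i) \<in> \<tau> i" if "i \<in> {1..q}" for i
    unfolding ray[OF that] ray_through_def by (intro CollectI exI[of _ 1]) simp
  have a_C: "a i \<in> C" if "i \<in> {1..q}" for i
    using a_ray[OF that] ray_L[OF that] by (auto simp: C_iff)
  have aC: "of_nat k * a i \<in> C" if "i \<in> {1..q}" for i k
    using C_sub a_C[OF that] by (induction k) (auto simp: add_submonoid_def distrib_right)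

  have decomp: "\<exists>P\<in>box_points q a. \<exists>n. x = P + (\<Sum>i\<in>{1..q}. of_nat (n i) * a i)"
    if "x \<in> C" for x
  proof -
    have pos: "0 < (\<chi> k. 1) \<bullet> x" if x: "x \<in> L" "x \<noteq> 0" for x
    proof -
      have nonneg: "0 \<le> x $ k" for k using x(1) by (simp add: L_eq)
      moreover obtain k where "x $ k \<noteq> 0" using x(2) by (auto simp: vec_eq_iff)
      ultimately have "0 < x $ k" by (simp add: less_le)
      then show ?thesis
        using nonneg by (auto simp: inner_vec_def intro!: sum_pos2[of _ k])
    qed
    have "L \<subseteq> convex_cone hull (\<Union>i\<in>{1..q}. ray_through (a i))"
      using pointed_cone_spanned_by_edges[OF \<open>closed L\<close> cone pos] ray by (simp add: edges)
    then have "of_nat_vec x \<in> convex_cone hull (\<Union>i\<in>{1..q}. ray_through (a i))"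
      using that by (auto simp: C_iff)
    from convex_cone_hull_rays[OF _ this] show ?thesis
      using lattice_point_box_decomposition[of q _ x a] by auto
  qed
  have box_C: "box_points q a \<subseteq> C"
  proof
    fix x assume "x \<in> box_points q a"
    then obtain l where l: "\<forall>i\<in>{1..q}. 0 \<le> l i" "(of_nat_vec x :: real^'p) = (\<Sum>i\<in>{1..q}. l i *\<^sub>R of_nat_vec (a i))"
      by (auto simp: box_points_def)
    have "add_submonoid L"
      using cone by (intro add_submonoidI) (simp_all add: convex_cone_contains_0 convex_cone_add)
    then have "(\<Sum>i\<in>{1..q}. l i *\<^sub>R of_nat_vec (a i)) \<in> L"
      using l(1) a_C cone by (intro add_submonoid_sum) (auto simp: C_iff convex_cone_scaleR)
    then show "x \<in> C"
      using l(2) by (simp add: C_iff)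
  qed
  have a_box: "a i \<in> box_points q a" if "i \<in> {1..q}" for i
    unfolding box_points_def using that
    by (intro CollectI exI[of _ "\<lambda>j. if j = i then 1 else 0"]) (auto simp: if_distrib[of "\<lambda>c. c *\<^sub>R _"] cong: if_cong)
  have C_hull: "add_submonoid hull (box_points q a) = C"
  proof
    show "add_submonoid hull (box_points q a) \<subseteq> C"
      using box_C C_sub by (rule hull_minimal)
    let ?H = "add_submonoid hull (box_points q a)"
    have H: "add_submonoid ?H" by (rule add_submonoid_hull)
    have "of_nat k * a i \<in> ?H" if "i \<in> {1..q}" for i k
      using H hull_inc[OF a_box[OF that], of add_submonoid]
      by (induction k) (auto simp: add_submonoid_def distrib_right)
    then have "(\<Sum>i\<in>{1..q}. of_nat (n i) * a i) \<in> ?H" for n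
      using H by (intro add_submonoid_sum)
    then show "C \<subseteq> ?H"
      using decomp H hull_inc[of _ "box_points q a" add_submonoid] unfolding add_submonoid_def by blast
  qed

  \<comment> \<open>Since the box points generate \<open>C\<close>, the monoid \<open>T\<^sub>i\<close> is the full image of \<open>C\<close>.\<close>
  let ?\<Upsilon> = "\<lambda>i. hyperplane_values h (J i)"
  have T_eq: "value_monoid q a h (J i) = ?\<Upsilon> i ` C" for i
    unfolding value_monoid_def C_hull[symmetric]
    by (rule hull_image_additive) (rule hyperplane_values_0, rule hyperplane_values_add)
  have J_t: "J i \<subseteq> {1..t}" if "i \<in> {1..q}" for i
    using assms(6)[OF that] by (auto simp: hyperplanes_containing_def)
  have \<Upsilon>_nonneg: "0 \<le> ?\<Upsilon> i x j" if "x \<in> C" "i \<in> {1..q}" for x i j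
    using that J_t by (auto simp: C_iff L_eq hyperplane_values_def lin_form_of_nat_vec)
  have \<Upsilon>_a: "?\<Upsilon> i (a i) = 0" if "i \<in> {1..q}" for i
  proof -
    have "(lin_form (h j) (of_nat_vec (a i)) :: real) = 0" if "j \<in> J i" for j
      using assms(6)[OF \<open>i \<in> {1..q}\<close>] a_ray[OF \<open>i \<in> {1..q}\<close>] that by (auto simp: hyperplanes_containing_def)
    then show ?thesis
      by (auto simp: hyperplane_values_def fun_eq_iff lin_form_of_nat_vec)
  qed
  have \<Gamma>_hull: "add_submonoid hull \<Gamma> i = ?\<Upsilon> i ` C" if "i \<in> {1..q}" for i
    using assms(10)[OF that] by (simp add: minimal_generating_set_def T_eq)
  have \<Gamma>_T: "\<Gamma> i \<subseteq> ?\<Upsilon> i ` C" if "i \<in> {1..q}" for i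
    using \<Gamma>_hull[OF that] hull_subset[of "\<Gamma> i" add_submonoid] by simp
  have line_iff: "of_nat_vec ` \<Lambda> \<inter> solution_line h (J i) \<alpha> \<noteq> {} \<longleftrightarrow> \<alpha> \<in> ?\<Upsilon> i ` \<Lambda>"
    if "\<alpha> \<in> \<Gamma> i" "i \<in> {1..q}" for i \<alpha>
  proof -
    have "\<alpha> j = 0" if "j \<notin> J i" for j
      using \<Gamma>_T[OF \<open>i \<in> {1..q}\<close>] \<open>\<alpha> \<in> \<Gamma> i\<close> that by (auto simp: hyperplane_values_def)
    then have "of_nat_vec P \<in> solution_line h (J i) \<alpha> \<longleftrightarrow> ?\<Upsilon> i P = \<alpha>" for P
      by (rule of_nat_vec_in_solution_line_iff)
    then show ?thesis by (auto simp: image_iff)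
  qed

  have "finite (C - S) \<longleftrightarrow> (\<forall>i\<in>{1..q}. finite (\<tau> i \<inter> of_nat_vec ` (C - S))) \<and> (\<forall>i\<in>{1..q}. \<Gamma> i \<subseteq> ?\<Upsilon> i ` \<Lambda>)"
  proof (intro iffI conjI ballI)
    fix i assume fin: "finite (C - S)" and i: "i \<in> {1..q}"
    show "finite (\<tau> i \<inter> of_nat_vec ` (C - S))"
      using fin by auto
    show "\<Gamma> i \<subseteq> ?\<Upsilon> i ` \<Lambda>"
    proof
      fix \<alpha> assume \<alpha>: "\<alpha> \<in> \<Gamma> i"
      then obtain Q where Q: "Q \<in> C" "\<alpha> = ?\<Upsilon> i Q"
        using \<Gamma>_T[OF i] by blast
      have "infinite (range (\<lambda>k. Q + of_nat k * a i))"
        using inj_translates[OF a0[OF i]] by (rule range_inj_infinite)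
      then have "\<not> range (\<lambda>k. Q + of_nat k * a i) \<subseteq> C - S"
        using fin finite_subset by blast
      moreover have "Q + of_nat k * a i \<in> C" for k
        using C_sub Q(1) aC[OF i] by (simp add: add_submonoid_def)
      ultimately obtain k where k: "Q + of_nat k * a i \<in> S"
        by auto
      have pointed: "x = 0" if "x \<in> ?\<Upsilon> i ` C" "y \<in> ?\<Upsilon> i ` C" "x + y = 0" for x y
      proof
        fix j
        have "0 \<le> x j" "0 \<le> y j" using that \<Upsilon>_nonneg i by auto
        moreover have "x j + y j = 0" using that(3) by (simp add: fun_eq_iff)
        ultimately show "x j = 0 j" by simp
      qed
      note irr = minimal_generator_irreducible[OF assms(10)[OF i, unfolded T_eq] \<alpha> pointed]
      \<comment> \<open>If a sum has value \<open>\<alpha>\<close>, irreducibility gives that value to one of its two summands; hence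
        the set on the right is closed under addition.\<close>
      have "S \<subseteq> {x \<in> C. ?\<Upsilon> i x = \<alpha> \<longrightarrow> \<alpha> \<in> ?\<Upsilon> i ` \<Lambda>}"
        unfolding S_hull
      proof (rule hull_minimal)
        show "\<Lambda> \<subseteq> {x \<in> C. ?\<Upsilon> i x = \<alpha> \<longrightarrow> \<alpha> \<in> ?\<Upsilon> i ` \<Lambda>}"
          using \<open>S \<subseteq> C\<close> hull_subset[of \<Lambda> add_submonoid] S_hull by auto
        show "add_submonoid {x \<in> C. ?\<Upsilon> i x = \<alpha> \<longrightarrow> \<alpha> \<in> ?\<Upsilon> i ` \<Lambda>}"
        proof (rule add_submonoidI)
          show "0 \<in> {x \<in> C. ?\<Upsilon> i x = \<alpha> \<longrightarrow> \<alpha> \<in> ?\<Upsilon> i ` \<Lambda>}"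
            using C_sub irr(1) by (auto simp: add_submonoid_def hyperplane_values_0)
          fix x y
          assume xy: "x \<in> {x \<in> C. ?\<Upsilon> i x = \<alpha> \<longrightarrow> \<alpha> \<in> ?\<Upsilon> i ` \<Lambda>}"
            "y \<in> {x \<in> C. ?\<Upsilon> i x = \<alpha> \<longrightarrow> \<alpha> \<in> ?\<Upsilon> i ` \<Lambda>}"
          have "\<alpha> \<in> ?\<Upsilon> i ` \<Lambda>" if "?\<Upsilon> i (x + y) = \<alpha>"
          proof -
            have e: "\<alpha> = ?\<Upsilon> i x + ?\<Upsilon> i y"
              using that by (simp add: hyperplane_values_add)
            then have "?\<Upsilon> i x = 0 \<or> ?\<Upsilon> i y = 0"
              using xy by (intro irr(2)) auto
            then have "?\<Upsilon> i y = \<alpha> \<or> ?\<Upsilon> i x = \<alpha>"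
              using e by auto
            then show ?thesis using xy by auto
          qed
          then show "x + y \<in> {x \<in> C. ?\<Upsilon> i x = \<alpha> \<longrightarrow> \<alpha> \<in> ?\<Upsilon> i ` \<Lambda>}"
            using xy C_sub by (auto simp: add_submonoid_def)
        qed
      qed
      moreover have "?\<Upsilon> i (Q + of_nat k * a i) = \<alpha>"
        using Q hyperplane_values_mult[OF \<Upsilon>_a[OF i]] by (simp add: hyperplane_values_add)
      ultimately show "\<alpha> \<in> ?\<Upsilon> i ` \<Lambda>"
        using k by blast
    qed
  next
    assume cond: "(\<forall>i\<in>{1..q}. finite (\<tau> i \<inter> of_nat_vec ` (C - S))) \<and> (\<forall>i\<in>{1..q}. \<Gamma> i \<subseteq> ?\<Upsilon> i ` \<Lambda>)"
    have ev: "eventually (\<lambda>k. P + of_nat k * a i \<in> S) sequentially" if P: "P \<in> C" and i: "i \<in> {1..q}" for P i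
    proof -
      \<comment> \<open>Both sides are monoids, so it is enough that \<open>\<Upsilon>\<^sub>i(\<Lambda>)\<close> contains the generators of the left one.\<close>
      have "?\<Upsilon> i ` C \<subseteq> ?\<Upsilon> i ` S"
        unfolding \<Gamma>_hull[OF i, symmetric] S_hull
          hull_image_additive[of "?\<Upsilon> i", OF hyperplane_values_0 hyperplane_values_add, symmetric]
        using cond i by (intro hull_mono) auto
      then obtain s where s: "s \<in> S" "?\<Upsilon> i P = ?\<Upsilon> i s"
        using P by blast
      have "lin_form (h j) (of_nat_vec P - of_nat_vec s :: real^'p) = 0" if "j \<in> J i" for j
        using that fun_cong[OF s(2), of j]
        by (simp add: lin_form_diff lin_form_of_nat_vec hyperplane_values_def)
      then have "of_nat_vec P - of_nat_vec s \<in> span (\<tau> i)"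
        using assms(8)[OF i] by blast
      moreover have "\<tau> i \<subseteq> span {of_nat_vec (a i)}"
        unfolding ray[OF i] by (auto simp: ray_through_def span_singleton)
      then have "span (\<tau> i) \<subseteq> span {of_nat_vec (a i)}"
        by (simp add: span_minimal)
      ultimately obtain r where r: "of_nat_vec P - of_nat_vec s = r *\<^sub>R (of_nat_vec (a i) :: real^'p)"
        by (auto simp: span_singleton)
      have "ray_through (a i) \<inter> of_nat_vec ` (- S) \<subseteq> \<tau> i \<inter> of_nat_vec ` (C - S)"
        using ray[OF i] ray_L[OF i] by (auto simp: C_iff)
      then have "finite (ray_through (a i) \<inter> of_nat_vec ` (- S))"
        using cond i finite_subset by blast
      from eventually_translate_in_submonoid[OF S_sub s(1) a0[OF i] r this] show ?thesis .
    qed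
    show "finite (C - S)"
      using finite_complement_of_submonoid[OF finite_box_points[of q a] _ S_sub C_sub box_C a_C decomp ev]
      by auto
  qed
  then show ?thesis
    using assms(1) \<open>S \<subseteq> C\<close> line_iff unfolding C_semigroup_def C_def by (auto simp: subset_iff)
qed

end
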